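(* Let $f(x)\in\mathbb{Z}[x]$ be a polynomial all of whose coefficients are nonnegative integers and whose degree is at least $2$. Let $n$ and $k$ be integers with $1\le k\le n$, and let $$\sigma_{k,f}(n)=\sum_{1\le i_1<i_2<\cdots<i_k\le n}\prod_{j=1}^{k}\frac{1}{f(i_j)}$$ be the $k$-th elementary symmetric function of $1/f(1),1/f(2),\dots,1/f(n)$. Then $\sigma_{k,f}(n)$ is not an integer, except in the case $f(x)=x^m$ for some integer $m\ge 2$ and $k=n=1$, in which case $\sigma_{k,f}(n)$ is an integer. *)

theory Defs
  imports Complex_Main "HOL-Computational_Algebra.Polynomial"
begin

text \<open>
  The index tuples \<open>1 \<le> i\<^sub>1 < \<dots> < i\<^sub>k \<le> n\<close> are represented by
  the \<open>k\<close>-element subsets of \<open>{1..n}\<close>.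
\<close>

definition sigma_recip :: "nat \<Rightarrow> int poly \<Rightarrow> nat \<Rightarrow> rat" where
  "sigma_recip k f n =
     (\<Sum>I | I \<subseteq> {1..n} \<and> card I = k. \<Prod>i\<in>I. 1 / rat_of_int (poly f (int i)))"

end

theory Submission
  imports Defs
begin

text \<open>
  Since \<open>f i \<ge> i\<^sup>2\<close>, the sums are dominated by the elementary symmetric functions of the
  numbers \<open>1 / i\<^sup>2\<close>. For \<open>k \<ge> 2\<close> these lie strictly between \<open>0\<close> and \<open>1\<close>: for \<open>k = 2\<close> by
  Newton's identity \<open>2 e\<^sub>2 = e\<^sub>1\<^sup>2 - p\<^sub>2\<close> and \<open>e\<^sub>1 \<le> 5/3\<close>, \<open>p\<^sub>2 \<ge> 1\<close>, and then for larger \<open>k\<close>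
  by \<open>e\<^sub>k n = (\<Sum>j=2..n. e\<^sub>k\<^sub>-\<^sub>1 (j - 1) / j\<^sup>2)\<close> and \<open>(\<Sum>j\<ge>2. 1 / j\<^sup>2) < 1\<close>.
  For \<open>k = 1\<close> the sum is less than \<open>2\<close>, and it must be shown that it is not \<open>1\<close>. If \<open>f = x^m\<close>,
  it exceeds \<open>1\<close> as soon as \<open>n \<ge> 2\<close>. Otherwise \<open>f\<close> dominates \<open>x\<^sup>2 + x\<close> or \<open>x\<^sup>2 + 2\<close>, and then
  the sum stays below \<open>1\<close>, or \<open>f = x\<^sup>2 + 1\<close>, and then the partial sums jump over \<open>1\<close> between
  \<open>n = 12\<close> and \<open>n = 13\<close>.
\<close>

section \<open>Elementary symmetric functions of an arbitrary sequence\<close>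

definition esym :: "nat \<Rightarrow> nat \<Rightarrow> (nat \<Rightarrow> 'a::comm_semiring_1) \<Rightarrow> 'a" where
  "esym k n a = (\<Sum>I | I \<subseteq> {1..n} \<and> card I = k. \<Prod>i\<in>I. a i)"

lemma finite_subsets_card: "finite {I. I \<subseteq> {1..n::nat} \<and> card I = k}"
  by (rule finite_subset[of _ "Pow {1..n}"]) auto

lemma esym_0 [simp]: "esym 0 n a = 1"
proof -
  have "{I. I \<subseteq> {1..n} \<and> card I = 0} = {{}}"
    by (auto dest: finite_subset)
  then show ?thesis by (simp add: esym_def)
qed

lemma esym_Suc_0 [simp]: "esym (Suc k) 0 a = 0"
proof -
  have "{I. I \<subseteq> {1..0::nat} \<and> card I = Suc k} = {}" by auto
  then show ?thesis by (simp only: esym_def sum.empty)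
qed

text \<open>The subsets of size \<open>Suc k\<close> split according to whether they contain
  \<open>Suc n\<close>; removing \<open>Suc n\<close> from those that do leaves the subsets of
  \<open>{1..n}\<close> of size \<open>k\<close>.\<close>

lemma esym_Suc_Suc:
  "esym (Suc k) (Suc n) a = esym (Suc k) n a + a (Suc n) * esym k n a"
proof -
  let ?A = "{I. I \<subseteq> {1..n} \<and> card I = Suc k}"
  let ?B = "{I. I \<subseteq> {1..n} \<and> card I = k}"
  have fin: "finite I" if "I \<subseteq> {1..n}" for I
    using that finite_subset by blast
  have notin: "Suc n \<notin> I" if "I \<subseteq> {1..n}" for I
    using that by auto
  have split: "{I. I \<subseteq> {1..Suc n} \<and> card I = Suc k} = ?A \<union> insert (Suc n) ` ?B"
  proof (intro equalityI subsetI)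
    fix I assume I: "I \<in> {I. I \<subseteq> {1..Suc n} \<and> card I = Suc k}"
    show "I \<in> ?A \<union> insert (Suc n) ` ?B"
    proof (cases "Suc n \<in> I")
      case True
      moreover have "I - {Suc n} \<in> ?B"
        using I True by (auto simp: atLeastAtMostSuc_conv)
      moreover have "I = insert (Suc n) (I - {Suc n})" using True by blast
      ultimately show ?thesis by blast
    next
      case False
      then show ?thesis using I by (auto simp: atLeastAtMostSuc_conv)
    qed
  next
    fix I assume "I \<in> ?A \<union> insert (Suc n) ` ?B"
    then show "I \<in> {I. I \<subseteq> {1..Suc n} \<and> card I = Suc k}"
      using fin notin by (fastforce simp: card_insert_if)
  qed
  have inj: "inj_on (insert (Suc n)) ?B"
    using notin by (intro inj_onI) (metis (mono_tags, lifting) insert_ident mem_Collect_eq)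
  have "esym (Suc k) (Suc n) a = (\<Sum>I\<in>?A. prod a I) + (\<Sum>I\<in>insert (Suc n) ` ?B. prod a I)"
    unfolding esym_def split
    using notin by (intro sum.union_disjoint) (auto intro: finite_subsets_card)
  also have "(\<Sum>I\<in>insert (Suc n) ` ?B. prod a I) = (\<Sum>I\<in>?B. a (Suc n) * prod a I)"
    unfolding sum.reindex[OF inj] using fin notin by (intro sum.cong) auto
  finally show ?thesis
    by (simp add: esym_def sum_distrib_left)
qed

lemma esym_1: "esym 1 n a = (\<Sum>i=1..n. a i)"
  by (induction n) (simp_all add: esym_Suc_Suc)

lemma esym_2: "2 * esym 2 n a + (\<Sum>i=1..n. a i ^ 2) = (\<Sum>i=1..n. a i) ^ 2"
proof (induction n)
  case 0
  then show ?case by (simp add: numeral_2_eq_2)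
next
  case (Suc n)
  have "esym 2 (Suc n) a = esym 2 n a + a (Suc n) * (\<Sum>i=1..n. a i)"
    using esym_Suc_Suc[of 1 n a] unfolding esym_1 by (simp add: numeral_2_eq_2)
  then show ?case
    using Suc.IH[symmetric] by (simp add: power2_eq_square algebra_simps mult_2)
qed

lemma esym_mono:
  fixes a b :: "nat \<Rightarrow> 'a::linordered_idom"
  assumes "\<And>i. i \<in> {1..n} \<Longrightarrow> 0 \<le> a i \<and> a i \<le> b i"
  shows "esym k n a \<le> esym k n b"
  unfolding esym_def using assms by (intro sum_mono prod_mono) blast

lemma esym_pos:
  fixes a :: "nat \<Rightarrow> 'a::linordered_idom"
  assumes "\<And>i. i \<in> {1..n} \<Longrightarrow> 0 < a i" and "k \<le> n"
  shows "0 < esym k n a"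
  unfolding esym_def
proof (rule sum_pos)
  have "{1..k} \<in> {I. I \<subseteq> {1..n} \<and> card I = k}" using assms(2) by auto
  then show "{I. I \<subseteq> {1..n} \<and> card I = k} \<noteq> {}" by blast
  show "0 < prod a I" if "I \<in> {I. I \<subseteq> {1..n} \<and> card I = k}" for I
    using that assms(1) by (intro prod_pos) blast
qed (rule finite_subsets_card)

section \<open>Telescoping bounds and the inverse squares\<close>

lemma sum_telescope_bound:
  fixes a b :: "nat \<Rightarrow> 'a::linordered_idom"
  assumes "\<And>i. m \<le> i \<Longrightarrow> a (Suc i) \<le> b i - b (Suc i)"
    and "(\<Sum>i=1..m. a i) \<le> C - b m" and "m \<le> n"
  shows "(\<Sum>i=1..n. a i) \<le> C - b n"
  using assms(3)
\<comment> \<open>The term \<open>- b n\<close> kept in the bound absorbs the next summand.\<close>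
proof (induction n rule: dec_induct)
  case (step n)
  then show ?case using assms(1)[of n] by simp
qed (use assms(2) in simp)

lemma sum_inverse_squares_le: "(\<Sum>i=1..n. 1 / rat_of_nat i ^ 2) \<le> 5/3"
proof (cases "n = 0")
  case False
  \<comment> \<open>Here \<open>b i\<close> is 1/(i + 1/2), so \<open>b i - b (Suc i)\<close> =
    1/((i+1)^2 - 1/4) exceeds 1/(i+1)^2. The constant is 1 + \<open>b 1\<close> = 5/3.\<close>
  define b where "b i = 2 / (2 * rat_of_nat i + 1)" for i
  have "(\<Sum>i=1..n. 1 / rat_of_nat i ^ 2) \<le> 5/3 - b n"
  proof (rule sum_telescope_bound[where m = 1])
    show "1 / rat_of_nat (Suc i) ^ 2 \<le> b i - b (Suc i)" for i
      by (simp add: b_def divide_simps add_pos_nonneg power2_eq_square)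
         (simp add: algebra_simps)
  qed (use False in \<open>auto simp: b_def\<close>)
  moreover have "0 \<le> b n" by (simp add: b_def)
  ultimately show ?thesis by linarith
qed simp

lemma esym_inverse_squares_lt_1:
  assumes "k \<ge> 2"
  shows "esym k n (\<lambda>i. 1 / rat_of_nat i ^ 2) < 1"
  using assms
proof (induction k arbitrary: n rule: dec_induct)
  case base
  let ?a = "\<lambda>i. 1 / rat_of_nat i ^ 2"
  show ?case
  proof (cases "n = 0")
    case False
    \<comment> \<open>The term \<open>i = 1\<close> already gives 1, so Newton's identity yields
      \<open>2 * esym 2 n ?a\<close> \<le> 25/9 - 1 = 16/9 < 2.\<close>
    have "?a 1 ^ 2 \<le> (\<Sum>i=1..n. ?a i ^ 2)"
      using False by (intro member_le_sum) auto
    moreover have "(\<Sum>i=1..n. ?a i) ^ 2 \<le> (5/3) ^ 2"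
      by (intro power_mono sum_inverse_squares_le sum_nonneg) auto
    ultimately show ?thesis
      using esym_2[of n ?a] by (simp add: power2_eq_square)
  qed (simp add: numeral_2_eq_2)
next
  case (step k)
  let ?a = "\<lambda>i. 1 / rat_of_nat i ^ 2"
  \<comment> \<open>The slack 1/(n+1) makes the inner induction work: the next term is at most
    1/(n+2)^2, which is at most 1/(n+1) - 1/(n+2). For \<open>n = 0\<close> both sides vanish, since
    one element has no subset of size \<open>Suc k\<close> \<ge> 3.\<close>
  have bound: "esym (Suc k) (Suc n) ?a \<le> 1 - 1 / rat_of_nat (Suc n)" for n
  proof (induction n)
    case 0
    then show ?case using step.hyps by (cases k) (simp_all add: esym_Suc_Suc)
  next
    case (Suc n)
    have "?a (Suc (Suc n)) * esym k (Suc n) ?a \<le> ?a (Suc (Suc n)) * 1"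
      using step.IH[of "Suc n"] by (intro mult_left_mono) auto
    also have "\<dots> \<le> 1 / rat_of_nat (Suc n) - 1 / rat_of_nat (Suc (Suc n))"
      by (simp add: divide_simps add_pos_nonneg power2_eq_square)
    finally show ?case
      using Suc.IH by (subst esym_Suc_Suc) linarith
  qed
  show ?case
  proof (cases n)
    case (Suc m)
    have "0 < 1 / rat_of_nat (Suc m)" by simp
    then show ?thesis using bound[of m] unfolding Suc by linarith
  qed simp
qed

section \<open>Integrality and lower bounds for the polynomial\<close>

lemma not_Ints_between:
  fixes x :: rat
  assumes "of_int m < x" and "x < of_int m + 1"
  shows "x \<notin> \<int>"
proof
  assume "x \<in> \<int>"
  then obtain j where "x = of_int j" by (auto elim: Ints_cases)
  then have "of_int m < (of_int j :: rat)" "(of_int j :: rat) < of_int (m + 1)"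
    using assms by auto
  then have "m < j" "j < m + 1" by (simp_all only: of_int_less_iff)
  then show False by simp
qed

lemma coeff_mult_power_le_poly:
  fixes f :: "int poly"
  assumes "\<And>i. coeff f i \<ge> 0" and "x \<ge> 0"
  shows "coeff f i * x ^ i \<le> poly f x"
proof (cases "i \<le> degree f")
  case True
  then show ?thesis unfolding poly_altdef
    using assms by (intro member_le_sum) auto
next
  case False
  then show ?thesis
    using assms by (simp add: coeff_eq_0 poly_altdef sum_nonneg)
qed

lemma square_le_poly:
  fixes f :: "int poly"
  assumes "\<And>i. coeff f i \<ge> 0" and "degree f \<ge> 2" and "x \<ge> 1"
  shows "x\<^sup>2 \<le> poly f x"
proof -
  have "lead_coeff f \<noteq> 0" using assms(2) by auto
  then have "1 \<le> lead_coeff f" using assms(1)[of "degree f"] by linarith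
  then have "1 * x ^ 2 \<le> lead_coeff f * x ^ degree f"
    using assms by (intro mult_mono power_increasing) auto
  also have "\<dots> \<le> poly f x"
    using assms by (intro coeff_mult_power_le_poly) auto
  finally show ?thesis by simp
qed

text \<open>Subtract x^d, where d is the degree. The remainder is zero, or has a positive
  coefficient of positive index and so contributes at least x, or is a positive constant c. In the
  last situation the cases d \<ge> 3, c = 1 and c \<ge> 2 are separated.\<close>

lemma nonneg_poly_cases:
  fixes f :: "int poly"
  assumes nonneg: "\<And>i. coeff f i \<ge> 0" and deg: "degree f \<ge> 2"
  obtains "f = monom 1 (degree f)"
    | "f = [:1, 0, 1:]"
    | "\<And>x. x \<ge> 1 \<Longrightarrow> x\<^sup>2 + x \<le> poly f x"
    | "\<And>x. x \<ge> 1 \<Longrightarrow> x\<^sup>2 + 2 \<le> poly f x"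
proof -
  define d where "d = degree f"
  define g where "g = f - monom 1 d"
  have f_eq: "poly f x = x ^ d + poly g x" for x
    by (simp add: g_def poly_monom)
  have "lead_coeff f \<noteq> 0" using deg by auto
  then have "1 \<le> lead_coeff f" using nonneg[of "degree f"] by linarith
  \<comment> \<open>A leading coefficient above 1 leaves its excess in \<open>g\<close>.\<close>
  then have g_nonneg: "coeff g i \<ge> 0" for i
    using nonneg[of i] by (auto simp: g_def d_def)
  have g_ge: "coeff g i * x ^ i \<le> poly g x" if "x \<ge> 1" for i x
    using that g_nonneg by (intro coeff_mult_power_le_poly) auto
  consider "g = 0" | i where "i \<ge> 1" "coeff g i \<ge> 1" | c where "c \<ge> 1" "g = [:c:]"
  proof (cases "\<exists>i\<ge>1. coeff g i \<noteq> 0")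
    case True
    then obtain i where "i \<ge> 1" "coeff g i \<noteq> 0" by blast
    then show ?thesis using that(2)[of i] g_nonneg[of i] by linarith
  next
    case False
    then have g: "g = [:coeff g 0:]"
      by (intro poly_eqI) (auto simp: coeff_pCons split: nat.split)
    show ?thesis
    proof (cases "coeff g 0 = 0")
      case True
      then show ?thesis using g that(1) by simp
    next
      case nz: False
      then show ?thesis using g that(3)[of "coeff g 0"] g_nonneg[of 0] by linarith
    qed
  qed
  then show ?thesis
  proof cases
    case 1
    then show ?thesis using that(1) by (simp add: g_def d_def)
  next
    case (2 i)
    have "x\<^sup>2 + x \<le> poly f x" if "x \<ge> 1" for x
    proof -
      have "1 * x ^ 1 \<le> coeff g i * x ^ i"
        using 2 that by (intro mult_mono power_increasing) auto
      moreover have "x ^ 2 \<le> x ^ d"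
        using deg that unfolding d_def by (intro power_increasing) auto
      ultimately show ?thesis using g_ge[OF that, of i] f_eq[of x] by simp
    qed
    then show ?thesis by (rule that(3))
  next
    case (3 c)
    consider "d \<ge> 3" | "d = 2" "c = 1" | "d = 2" "c \<ge> 2"
      using deg 3(1) by (fastforce simp: d_def)
    then show ?thesis
    proof cases
      case 1
      have "x\<^sup>2 + x \<le> poly f x" if "x \<ge> 1" for x
      proof -
        have "x ^ 3 \<le> x ^ d" using 1 that by (intro power_increasing) auto
        \<comment> \<open>Expanded, this is x^3 + 1 \<ge> x^2 + x; the constant c supplies the
          1.\<close>
        moreover have "0 \<le> (x - 1) * (x\<^sup>2 - 1)"
          using that by (intro mult_nonneg_nonneg) auto
        ultimately show ?thesis
          using 3 f_eq[of x] by (simp add: algebra_simps power2_eq_square power3_eq_cube)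
      qed
      then show ?thesis by (rule that(3))
    next
      case 2
      have "f = g + monom 1 d" by (simp add: g_def)
      then have "f = [:1, 0, 1:]" using 3 2 by (simp add: monom_altdef power2_eq_square)
      then show ?thesis by (rule that(2))
    next
      case c: 3
      then show ?thesis using that(4) 3 f_eq by simp
    qed
  qed
qed

section \<open>Reciprocal sums of three quadratics\<close>

lemma sum_inverse_x2_plus_x_lt_1: "(\<Sum>i=1..n. 1 / (rat_of_nat i ^ 2 + rat_of_nat i)) < 1"
proof -
  \<comment> \<open>The telescoping is exact: the summand at i + 1 is 1/((i+1)(i+2)) = 1/(i+1) -
    1/(i+2).\<close>
  define b where "b i = 1 / rat_of_nat (Suc i)" for i
  have "(\<Sum>i=1..n. 1 / (rat_of_nat i ^ 2 + rat_of_nat i)) \<le> 1 - b n"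
  proof (rule sum_telescope_bound[where m = 0])
    show "1 / (rat_of_nat (Suc i) ^ 2 + rat_of_nat (Suc i)) \<le> b i - b (Suc i)" for i
      by (simp add: b_def divide_simps add_pos_nonneg power2_eq_square)
         (simp add: algebra_simps)
  qed (auto simp: b_def)
  moreover have "0 < b n" by (simp add: b_def)
  ultimately show ?thesis by linarith
qed

lemma sum_inverse_x2_plus_2_lt_1: "(\<Sum>i=1..n. 1 / (rat_of_nat i ^ 2 + 2)) < 1"
proof (cases "n \<ge> 2")
  case True
  \<comment> \<open>The same \<open>b\<close> as for the inverse squares. The first two terms and
    \<open>b 2\<close> give 1/3 + 1/6 + 2/5 = 9/10.\<close>
  define b where "b i = 2 / (2 * rat_of_nat i + 1)" for i
  have "(\<Sum>i=1..n. 1 / (rat_of_nat i ^ 2 + 2)) \<le> 9/10 - b n"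
  proof (rule sum_telescope_bound[where m = 2])
    show "1 / (rat_of_nat (Suc i) ^ 2 + 2) \<le> b i - b (Suc i)" for i
      by (simp add: b_def divide_simps add_pos_nonneg power2_eq_square)
         (simp add: algebra_simps)
    show "(\<Sum>i=1..2. 1 / (rat_of_nat i ^ 2 + 2)) \<le> 9/10 - b 2"
      by (simp add: b_def numeral_2_eq_2)
  qed (rule True)
  moreover have "0 \<le> b n" by (simp add: b_def)
  ultimately show ?thesis by linarith
next
  case False
  then have "n = 0 \<or> n = 1" by linarith
  then show ?thesis by auto
qed

lemma sum_inverse_x2_plus_1_not_Ints:
  assumes "n \<ge> 1"
  shows "(\<Sum>i=1..n. 1 / (rat_of_nat i ^ 2 + 1)) \<notin> \<int>"
proof -
  let ?S = "\<lambda>n. \<Sum>i=1..n. 1 / (rat_of_nat i ^ 2 + 1)"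
  have mono: "?S m \<le> ?S n" if "m \<le> n" for m n
    using that by (intro sum_mono2) auto
  have pos: "0 < ?S n"
    using assms by (intro sum_pos) (auto intro: add_nonneg_pos)
  have "?S n \<le> (\<Sum>i=1..n. 1 / rat_of_nat i ^ 2)"
    by (intro sum_mono frac_le) auto
  then have lt_2: "?S n < 2" using sum_inverse_squares_le[of n] by linarith
  show ?thesis
  proof (cases "n \<le> 12")
    case True
    \<comment> \<open>The value is about 0.997; the next term 1/170 lifts it to about 1.003.\<close>
    have "?S 12 < 1" by (simp add: sum.atLeast_Suc_atMost)
    then show ?thesis
      using mono[OF True] pos by (intro not_Ints_between[of 0]) simp_all
  next
    case False
    have "1 < ?S 13" by (simp add: sum.atLeast_Suc_atMost)
    then show ?thesis
      using mono[of 13 n] False lt_2 by (intro not_Ints_between[of 1]) simp_all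
  qed
qed

section \<open>Integrality by the size of \<open>k\<close> and the shape of \<open>f\<close>\<close>

theorem theorem1p1:
  fixes f :: "int poly" and n k :: nat
  assumes "\<And>i. coeff f i \<ge> 0"
    and "degree f \<ge> 2"
    and "1 \<le> k" and "k \<le> n"
  shows "sigma_recip k f n \<in> \<int> \<longleftrightarrow> (\<exists>m\<ge>2. f = monom 1 m) \<and> k = 1 \<and> n = 1"
proof -
  define a where "a i = 1 / rat_of_int (poly f (int i))" for i
  have sigma: "sigma_recip k f n = esym k n a"
    by (simp add: sigma_recip_def esym_def a_def)
  have a_pos: "0 < a i" if "i \<in> {1..n}" for i
  proof -
    have "0 < (int i)\<^sup>2" using that by simp
    also have "\<dots> \<le> poly f (int i)"
      using assms(1,2) that by (intro square_le_poly) auto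
    finally show ?thesis by (simp add: a_def)
  qed
  have a_le: "a i \<le> 1 / of_int (b (int i))"
    if "i \<in> {1..n}" and "b (int i) > 0" and "\<And>x. x \<ge> 1 \<Longrightarrow> b x \<le> poly f x" for b i
  proof -
    have "b (int i) \<le> poly f (int i)" using that by simp
    then show ?thesis unfolding a_def using that(2) by (intro frac_le) simp_all
  qed
  have a_le_square: "a i \<le> 1 / rat_of_nat i ^ 2" if "i \<in> {1..n}" for i
    using a_le[OF that, of "\<lambda>x. x\<^sup>2"] square_le_poly[OF assms(1,2)] that by simp
  have pos: "0 < esym k n a" using a_pos assms(4) by (rule esym_pos)
  show ?thesis
  proof (cases "k = 1")
    case False
    have "esym k n a \<le> esym k n (\<lambda>i. 1 / rat_of_nat i ^ 2)"
      using a_pos a_le_square by (intro esym_mono) (simp add: less_imp_le)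
    also have "\<dots> < 1"
      using False assms(3) by (intro esym_inverse_squares_lt_1) linarith
    finally have "esym k n a \<notin> \<int>"
      using pos by (intro not_Ints_between[of 0]) simp_all
    then show ?thesis using sigma False by simp
  next
    case True
    have n: "n \<ge> 1" using assms by simp
    have sum: "sigma_recip k f n = (\<Sum>i=1..n. a i)"
      using sigma True esym_1 by simp
    have lt_1: "(\<Sum>i=1..n. a i) \<notin> \<int>" if "(\<Sum>i=1..n. a i) < 1"
      using that pos sigma sum by (intro not_Ints_between[of 0]) simp_all
    \<comment> \<open>Every power of x takes the value 1 at 1, whereas \<open>poly f 1\<close> \<ge>
      2 in the last three cases below; there both sides of the equivalence are false.\<close>
    have not_monom: "\<nexists>m. f = monom 1 m" if "poly f 1 \<noteq> 1"
      using that by (auto simp: poly_monom)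
    from assms(1,2) show ?thesis
    proof (cases rule: nonneg_poly_cases)
      case 1
      have "poly f 1 = poly (monom 1 (degree f)) 1" using 1 by simp
      then have one: "a 1 = 1" by (simp add: a_def poly_monom)
      show ?thesis
      proof (cases "n = 1")
        case True
        then show ?thesis using \<open>k = 1\<close> sum one 1 assms(2) by auto
      next
        case False
        \<comment> \<open>For n \<ge> 2 the sum exceeds \<open>a 1\<close> = 1, while the bound 5/3
          keeps it below 2.\<close>
        have "a 1 + a 2 = (\<Sum>i\<in>{1,2}. a i)" by simp
        also have "\<dots> \<le> (\<Sum>i=1..n. a i)"
          using False n a_pos by (intro sum_mono2) (auto simp: less_imp_le)
        finally have "1 < (\<Sum>i=1..n. a i)" using one a_pos[of 2] False n by simp
        moreover have "(\<Sum>i=1..n. a i) < 2"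
          using sum_mono[of "{1..n}" a, OF a_le_square] sum_inverse_squares_le[of n] by simp
        ultimately have "(\<Sum>i=1..n. a i) \<notin> \<int>"
          by (intro not_Ints_between[of 1]) simp_all
        then show ?thesis using sum False by simp
      qed
    next
      case 2
      have "a i = 1 / (rat_of_nat i ^ 2 + 1)" for i
        by (simp add: a_def 2 power2_eq_square add.commute)
      then have "(\<Sum>i=1..n. a i) \<notin> \<int>"
        using sum_inverse_x2_plus_1_not_Ints[OF n] by simp
      moreover have "poly f 1 \<noteq> 1" by (simp add: 2)
      ultimately show ?thesis using sum not_monom by auto
    next
      case 3
      have "a i \<le> 1 / (rat_of_nat i ^ 2 + rat_of_nat i)" if "i \<in> {1..n}" for i
        using a_le[OF that, of "\<lambda>x. x\<^sup>2 + x"] 3 that by (simp add: add_nonneg_pos)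
      then have "(\<Sum>i=1..n. a i) < 1"
        by (rule le_less_trans[OF sum_mono sum_inverse_x2_plus_x_lt_1])
      then have "(\<Sum>i=1..n. a i) \<notin> \<int>" by (rule lt_1)
      moreover have "poly f 1 \<noteq> 1" using 3[of 1] by auto
      ultimately show ?thesis using sum not_monom by auto
    next
      case 4
      have "a i \<le> 1 / (rat_of_nat i ^ 2 + 2)" if "i \<in> {1..n}" for i
        using a_le[OF that, of "\<lambda>x. x\<^sup>2 + 2"] 4 that by (simp add: add_nonneg_pos)
      then have "(\<Sum>i=1..n. a i) < 1"
        by (rule le_less_trans[OF sum_mono sum_inverse_x2_plus_2_lt_1])
      then have "(\<Sum>i=1..n. a i) \<notin> \<int>" by (rule lt_1)
      moreover have "poly f 1 \<noteq> 1" using 4[of 1] by auto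
      ultimately show ?thesis using sum not_monom by auto
    qed
  qed
qed

end
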